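(* Let $S$ be a pomonoid. If all generators in $\mathbf{Pos}\text{-}S$ are weakly regularly $d$-injective, then all right $S$-posets are weakly regularly $d$-injective.
   Context: A pomonoid is a monoid $S$ (identity $1$) with a partial order $\leq$ such that $s\leq t$ and $s'\leq t'$ imply $ss'\leq tt'$. A (right) $S$-poset is a poset $A$ with a right monoid action $A\times S\to A$, $(a,s)\mapsto as$ ($a1=a$, $a(st)=(as)t$), that is order-preserving for the componentwise order on $A\times S$. $\mathbf{Pos}\text{-}S$ is the category of right $S$-posets with monotone action-preserving maps ($S$-poset maps). $S_S$ denotes $S$ regarded as a right $S$-poset via its multiplication. An $S$-poset $G$ is a generator in $\mathbf{Pos}\text{-}S$ if for any two distinct $S$-poset maps $\alpha,\beta:X\to Y$ there is an $S$-poset map $f:G\to X$ with $\alpha f\neq\beta f$. A right poideal of $S$ is a (possibly empty) subset $I\subseteq S$ with $IS\subseteq I$ that is a down-set ($a\leq b\in I$ implies $a\in I$); it is regarded as an $S$-poset with the order and action inherited from $S$. An $S$-poset $A$ is weakly regularly $d$-injective if it is injective with respect to all embeddings of right poideals into $S_S$, i.e. for every right poideal $I$ of $S$, with inclusion $i:I\to S_S$, and every $S$-poset map $u:I\to A$ there is an $S$-poset map $v:S_S\to A$ with $vi=u$.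
   Formalization: The S-posets in the conclusion are assumed nonempty: the empty one is never weakly regularly d-injective, so the claim fails for it, e.g. when S={1}. S and all S-posets, also those testing generators, have carriers in one arbitrary infinite universe, which loses nothing up to isomorphism. *)

theory Defs
  imports "HOL-Algebra.Group"
begin

text \<open>
  Orders are relations \<open>leq\<close> contained in \<open>carrier \<times> carrier\<close>; this containment is part of the
  library predicate \<^const>\<open>partial_order_on\<close>, so \<open>(a, b) \<in> leq S\<close> already implies that
  \<open>a\<close> and \<open>b\<close> lie in the carrier.
\<close>

record 'a ordered_monoid = "'a monoid" +
  leq :: "'a rel"

locale pomonoid = monoid S for S :: "('a, 'm) ordered_monoid_scheme" (structure) +
  assumes partial_order: "partial_order_on (carrier S) (leq S)"
    and mult_mono: "\<lbrakk>(s, t) \<in> leq S; (s', t') \<in> leq S\<rbrakk> \<Longrightarrow> (s \<otimes> s', t \<otimes> t') \<in> leq S"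

record ('s, 'a) sposet = "'a partial_object" +
  sleq :: "'a rel"
  act :: "'a \<Rightarrow> 's \<Rightarrow> 'a"

text \<open>The carrier of an \<open>S\<close>-poset may be empty, so that the empty poideal is one as well.\<close>

locale right_sposet = pomonoid S for S :: "('s, 'm) ordered_monoid_scheme" (structure) +
  fixes A :: "('s, 'a, 'n) sposet_scheme"
  assumes sposet_partial_order: "partial_order_on (carrier A) (sleq A)"
    and act_closed: "\<lbrakk>a \<in> carrier A; s \<in> carrier S\<rbrakk> \<Longrightarrow> act A a s \<in> carrier A"
    and act_one: "a \<in> carrier A \<Longrightarrow> act A a \<one> = a"
    and act_mult: "\<lbrakk>a \<in> carrier A; s \<in> carrier S; t \<in> carrier S\<rbrakk>
      \<Longrightarrow> act A a (s \<otimes> t) = act A (act A a s) t"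
    and act_mono: "\<lbrakk>(a, b) \<in> sleq A; (s, t) \<in> leq S\<rbrakk> \<Longrightarrow> (act A a s, act A b t) \<in> sleq A"

text \<open>
  As for \<^const>\<open>hom\<close>, the values of a map outside the carrier of its domain are unconstrained;
  maps are therefore compared on that carrier only.
\<close>

definition sposet_hom ::
  "('s, 'm) ordered_monoid_scheme \<Rightarrow> ('s, 'a, 'n) sposet_scheme \<Rightarrow> ('s, 'b, 'k) sposet_scheme
    \<Rightarrow> ('a \<Rightarrow> 'b) set" where
  "sposet_hom S A B =
    {f \<in> carrier A \<rightarrow> carrier B.
      (\<forall>a b. (a, b) \<in> sleq A \<longrightarrow> (f a, f b) \<in> sleq B) \<and>
      (\<forall>a \<in> carrier A. \<forall>s \<in> carrier S. f (act A a s) = act B (f a) s)}"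

definition regular_sposet :: "('s, 'm) ordered_monoid_scheme \<Rightarrow> ('s, 's) sposet" where
  "regular_sposet S = \<lparr>carrier = carrier S, sleq = leq S, act = mult S\<rparr>"

definition right_poideal :: "('s, 'm) ordered_monoid_scheme \<Rightarrow> 's set \<Rightarrow> bool" where
  "right_poideal S I \<longleftrightarrow>
    I \<subseteq> carrier S \<and>
    (\<forall>a \<in> I. \<forall>s \<in> carrier S. a \<otimes>\<^bsub>S\<^esub> s \<in> I) \<and>
    (\<forall>a b. (a, b) \<in> leq S \<longrightarrow> b \<in> I \<longrightarrow> a \<in> I)"

definition poideal_sposet :: "('s, 'm) ordered_monoid_scheme \<Rightarrow> 's set \<Rightarrow> ('s, 's) sposet" where
  "poideal_sposet S I = \<lparr>carrier = I, sleq = leq S \<inter> I \<times> I, act = mult S\<rparr>"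

definition weakly_regularly_d_injective ::
  "('s, 'm) ordered_monoid_scheme \<Rightarrow> ('s, 'a, 'n) sposet_scheme \<Rightarrow> bool" where
  "weakly_regularly_d_injective S A \<longleftrightarrow>
    (\<forall>I. right_poideal S I \<longrightarrow>
      (\<forall>u \<in> sposet_hom S (poideal_sposet S I) A.
        \<exists>v \<in> sposet_hom S (regular_sposet S) A. \<forall>x \<in> I. v x = u x))"

text \<open>
  The objects \<open>X\<close> and \<open>Y\<close> range over the \<open>S\<close>-posets with carrier in the type \<open>'a\<close> that also hosts
  \<open>G\<close>, so \<open>'a\<close> plays the role of the universe of sets from which \<open>Pos-S\<close> is built. If \<open>'a\<close> is
  infinite and \<open>S\<close> embeds into it, enlarging the universe does not change which \<open>G\<close> are
  generators: whenever \<open>G\<close> fails to be one, this is witnessed by \<open>X = S\<close> and the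
  amalgamated coproduct \<open>Y\<close> of two copies of \<open>S\<close> over the union of the images of all
  maps \<open>G \<rightarrow> S\<close>, where \<open>|Y| \<le> 2|S|\<close>.
\<close>

definition generator :: "('s, 'm) ordered_monoid_scheme \<Rightarrow> ('s, 'a) sposet \<Rightarrow> bool" where
  "generator S G \<longleftrightarrow>
    (\<forall>(X :: ('s, 'a) sposet) (Y :: ('s, 'a) sposet) \<alpha> \<beta>.
      right_sposet S X \<longrightarrow> right_sposet S Y \<longrightarrow>
      \<alpha> \<in> sposet_hom S X Y \<longrightarrow> \<beta> \<in> sposet_hom S X Y \<longrightarrow>
      (\<exists>x \<in> carrier X. \<alpha> x \<noteq> \<beta> x) \<longrightarrow>
      (\<exists>f \<in> sposet_hom S G X. \<exists>g \<in> carrier G. \<alpha> (f g) \<noteq> \<beta> (f g)))"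

lemma (in pomonoid) right_sposet_regular: "right_sposet S (regular_sposet S)"
  by unfold_locales (auto simp: regular_sposet_def partial_order m_assoc mult_mono)

lemma (in pomonoid) right_sposet_poideal:
  assumes "right_poideal S I"
  shows "right_sposet S (poideal_sposet S I)"
proof -
  have I: "I \<subseteq> carrier S" and closed: "\<And>a s. a \<in> I \<Longrightarrow> s \<in> carrier S \<Longrightarrow> a \<otimes> s \<in> I"
    using assms by (auto simp: right_poideal_def)
  have leq: "leq S \<subseteq> carrier S \<times> carrier S" "refl_on (carrier S) (leq S)"
      "trans (leq S)" "antisym (leq S)"
    using partial_order by (auto simp: partial_order_on_def preorder_on_def)
  have "partial_order_on I (leq S \<inter> I \<times> I)"
    unfolding partial_order_on_def preorder_on_def
    using leq I by (fastforce simp: refl_on_def intro: transI antisymI dest: transD antisymD)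
  then show ?thesis
    using I closed leq(1)
    by unfold_locales
      (auto simp: poideal_sposet_def subset_iff m_assoc mult_mono)
qed

text \<open>
  Since the empty poideal is admitted, the empty \<open>S\<close>-poset is never weakly regularly d-injective.
\<close>

lemma (in pomonoid) empty_not_weakly_regularly_d_injective:
  assumes "carrier A = {}"
  shows "\<not> weakly_regularly_d_injective S A"
proof
  assume "weakly_regularly_d_injective S A"
  moreover have "right_poideal S {}" by (simp add: right_poideal_def)
  moreover have "undefined \<in> sposet_hom S (poideal_sposet S {}) A"
    by (simp add: sposet_hom_def poideal_sposet_def)
  ultimately obtain v where "v \<in> sposet_hom S (regular_sposet S) A"
    unfolding weakly_regularly_d_injective_def by blast
  then have "v \<one> \<in> carrier A" by (auto simp: sposet_hom_def regular_sposet_def)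
  then show False using assms by simp
qed

end

theory Submission
  imports Defs
begin

text \<open>
  For a nonempty \<open>S\<close>-poset \<open>A\<close>, the product \<open>A \<times> S\<close> projects onto \<open>S\<close> and hence is a generator,
  so it is weakly regularly d-injective. Given \<open>u : I \<rightarrow> A\<close>, the map \<open>i \<mapsto> (u i, i)\<close> therefore
  extends to some \<open>v : S \<rightarrow> A \<times> S\<close>, and the first component of \<open>v\<close> extends \<open>u\<close>. Since the
  underlying type is infinite, it hosts an isomorphic copy of \<open>A \<times> S\<close>.
\<close>

lemma sposet_homI:
  assumes "\<And>a. a \<in> carrier A \<Longrightarrow> f a \<in> carrier B"
    and "\<And>a b. (a, b) \<in> sleq A \<Longrightarrow> (f a, f b) \<in> sleq B"
    and "\<And>a s. \<lbrakk>a \<in> carrier A; s \<in> carrier S\<rbrakk> \<Longrightarrow> f (act A a s) = act B (f a) s"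
  shows "f \<in> sposet_hom S A B"
  using assms by (auto simp: sposet_hom_def)

lemma sposet_hom_comp:
  assumes "f \<in> sposet_hom S A B" "g \<in> sposet_hom S B C"
  shows "g \<circ> f \<in> sposet_hom S A C"
  using assms by (auto simp: sposet_hom_def)

text \<open>The regular \<open>S\<close>-poset is free on \<open>\<one>\<close>: every point
  \<open>x\<close> gives a map sending \<open>\<one>\<close> to \<open>x\<close>. Monotonicity is
  \<open>act_mono\<close> applied to the reflexive pair \<open>(x, x)\<close>.\<close>

lemma (in right_sposet) sposet_hom_from_regular:
  assumes "x \<in> carrier A"
  shows "act A x \<in> sposet_hom S (regular_sposet S) A"
proof (rule sposet_homI)
  have "(x, x) \<in> sleq A"
    using assms sposet_partial_order
    by (auto simp: partial_order_on_def preorder_on_def refl_on_def)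
  then show "(act A x s, act A x t) \<in> sleq A" if "(s, t) \<in> sleq (regular_sposet S)" for s t
    using that by (auto simp: regular_sposet_def intro: act_mono)
qed (use assms in \<open>auto simp: regular_sposet_def act_closed act_mult\<close>)

text \<open>If \<alpha> and \<beta> differ at \<open>x\<close>, follow \<open>p\<close> by the map
  \<open>act X x\<close> out of the regular \<open>S\<close>-poset: a preimage of
  \<open>\<one>\<close> under \<open>p\<close> is then sent to \<open>x\<close> itself.\<close>

lemma (in pomonoid) generatorI:
  assumes p: "p \<in> sposet_hom S G (regular_sposet S)" and one: "\<one> \<in> p ` carrier G"
  shows "generator S G"
  unfolding generator_def
proof (intro allI impI)
  fix X Y :: "('a, 'c) sposet" and \<alpha> \<beta>
  assume X: "right_sposet S X" and \<alpha>: "\<alpha> \<in> sposet_hom S X Y" and \<beta>: "\<beta> \<in> sposet_hom S X Y"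
    and "\<exists>x \<in> carrier X. \<alpha> x \<noteq> \<beta> x"
  then obtain x where x: "x \<in> carrier X" "\<alpha> x \<noteq> \<beta> x" by blast
  interpret X: right_sposet S X by fact
  obtain g where g: "g \<in> carrier G" "p g = \<one>" using one by auto
  have "act X x \<circ> p \<in> sposet_hom S G X"
    using p X.sposet_hom_from_regular[OF x(1)] by (rule sposet_hom_comp)
  moreover have "(act X x \<circ> p) g = x" using g x by (simp add: X.act_one)
  ultimately show "\<exists>f \<in> sposet_hom S G X. \<exists>g \<in> carrier G. \<alpha> (f g) \<noteq> \<beta> (f g)"
    using g(1) x(2) by metis
qed

definition prod_sposet ::
  "('s, 'a, 'n) sposet_scheme \<Rightarrow> ('s, 'b, 'k) sposet_scheme \<Rightarrow> ('s, 'a \<times> 'b) sposet" where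
  "prod_sposet A B =
    \<lparr>carrier = carrier A \<times> carrier B,
     sleq = {((a, b), (a', b')). (a, a') \<in> sleq A \<and> (b, b') \<in> sleq B},
     act = \<lambda>(a, b) s. (act A a s, act B b s)\<rparr>"

lemma partial_order_on_prod:
  assumes "partial_order_on A r" "partial_order_on B q"
  shows "partial_order_on (A \<times> B) {((a, b), (a', b')). (a, a') \<in> r \<and> (b, b') \<in> q}"
  using assms unfolding partial_order_on_def preorder_on_def refl_on_def trans_def antisym_def
  by (auto; blast)

lemma right_sposet_prod:
  assumes "right_sposet S A" "right_sposet S B"
  shows "right_sposet S (prod_sposet A B)"
proof -
  interpret A: right_sposet S A by fact
  interpret B: right_sposet S B by fact
  show ?thesis
    using A.sposet_partial_order B.sposet_partial_order
    by unfold_locales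
      (auto simp: prod_sposet_def partial_order_on_prod A.act_closed B.act_closed A.act_one
        B.act_one A.act_mult B.act_mult A.act_mono B.act_mono)
qed

lemma fst_sposet_hom: "fst \<in> sposet_hom S (prod_sposet A B) A"
  by (auto simp: sposet_hom_def prod_sposet_def)

lemma snd_sposet_hom: "snd \<in> sposet_hom S (prod_sposet A B) B"
  by (auto simp: sposet_hom_def prod_sposet_def)

lemma pair_sposet_hom:
  assumes "f \<in> sposet_hom S C A" "g \<in> sposet_hom S C B"
  shows "(\<lambda>c. (f c, g c)) \<in> sposet_hom S C (prod_sposet A B)"
  using assms by (auto simp: sposet_hom_def prod_sposet_def)

text \<open>Transport of structure along \<open>e\<close>. When \<open>e\<close> is injective,
  \<open>inv_into UNIV e\<close> is a left inverse of it, and the result is an isomorphic copy of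
  \<open>A\<close> in another type.\<close>

definition image_sposet :: "('a \<Rightarrow> 'b) \<Rightarrow> ('s, 'a, 'n) sposet_scheme \<Rightarrow> ('s, 'b) sposet" where
  "image_sposet e A =
    \<lparr>carrier = e ` carrier A, sleq = map_prod e e ` sleq A,
     act = \<lambda>b s. e (act A (inv_into UNIV e b) s)\<rparr>"

text \<open>Injectivity lets a pair be recovered from its image, so that the middle terms match in
  transitivity and the two pairs are mutually reverse in antisymmetry.\<close>

lemma partial_order_on_image:
  assumes "inj e" "partial_order_on A r"
  shows "partial_order_on (e ` A) (map_prod e e ` r)"
  using assms unfolding partial_order_on_def preorder_on_def refl_on_def trans_def antisym_def
  by (auto simp: inj_eq; blast)

lemma right_sposet_image:
  assumes "inj e" "right_sposet S A"
  shows "right_sposet S (image_sposet e A)"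
proof -
  interpret A: right_sposet S A by fact
  show ?thesis
    using \<open>inj e\<close> A.sposet_partial_order
    by unfold_locales
      (auto simp: image_sposet_def partial_order_on_image A.act_closed A.act_one A.act_mult
        intro!: imageI A.act_mono)
qed

lemma image_sposet_hom: "inj e \<Longrightarrow> e \<in> sposet_hom S A (image_sposet e A)"
  by (auto simp: sposet_hom_def image_sposet_def)

lemma inv_image_sposet_hom: "inj e \<Longrightarrow> inv_into UNIV e \<in> sposet_hom S (image_sposet e A) A"
  by (auto simp: sposet_hom_def image_sposet_def)

text \<open>Lift \<open>u\<close> to \<open>B\<close>, extend the lift there, and push the extension
  down along \<open>p\<close>. Only maps out of poideals have to lift: a section of \<open>p\<close>
  would be too much to ask, since for the projection from \<open>A \<times> S\<close> to
  \<open>A\<close> it would require a map from \<open>A\<close> to \<open>S\<close>.\<close>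

lemma weakly_regularly_d_injective_retract:
  assumes B: "weakly_regularly_d_injective S B"
    and p: "p \<in> sposet_hom S B A"
    and lift: "\<And>I u. \<lbrakk>right_poideal S I; u \<in> sposet_hom S (poideal_sposet S I) A\<rbrakk>
      \<Longrightarrow> \<exists>w \<in> sposet_hom S (poideal_sposet S I) B. \<forall>x \<in> I. p (w x) = u x"
  shows "weakly_regularly_d_injective S A"
  unfolding weakly_regularly_d_injective_def
proof (intro allI impI ballI)
  fix I u
  assume I: "right_poideal S I" and u: "u \<in> sposet_hom S (poideal_sposet S I) A"
  obtain w where w: "w \<in> sposet_hom S (poideal_sposet S I) B" "\<forall>x \<in> I. p (w x) = u x"
    using lift[OF I u] by blast
  obtain v where v: "v \<in> sposet_hom S (regular_sposet S) B" "\<forall>x \<in> I. v x = w x"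
    using B I w(1) unfolding weakly_regularly_d_injective_def by blast
  show "\<exists>v \<in> sposet_hom S (regular_sposet S) A. \<forall>x \<in> I. v x = u x"
    using sposet_hom_comp[OF v(1) p] v(2) w(2) by (metis comp_apply)
qed

lemma poideal_inclusion_sposet_hom:
  assumes "right_poideal S I"
  shows "(\<lambda>x. x) \<in> sposet_hom S (poideal_sposet S I) (regular_sposet S)"
  using assms by (auto simp: sposet_hom_def poideal_sposet_def regular_sposet_def right_poideal_def)

text \<open>Cardinal arithmetic: an infinite set is equinumerous with its square.\<close>

lemma infinite_inj_prod:
  assumes "infinite (UNIV :: 'u set)"
  obtains e :: "'u \<times> 'u \<Rightarrow> 'u" where "inj e"
  using card_of_Times_same_infinite[OF assms, THEN ordIso_imp_ordLeq]
  by (auto simp: card_of_ordLeq[symmetric])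

text \<open>The empty \<open>S\<close>-poset has to be excluded: by
  \<open>empty_not_weakly_regularly_d_injective\<close> it never satisfies the conclusion, while the
  assumption concerns only generators, which are nonempty.\<close>

theorem proposition3p3:
  fixes S :: "'u ordered_monoid"
  assumes "infinite (UNIV :: 'u set)"
    and "pomonoid S"
    and "\<forall>G :: ('u, 'u) sposet.
      right_sposet S G \<longrightarrow> generator S G \<longrightarrow> weakly_regularly_d_injective S G"
  shows "\<forall>A :: ('u, 'u) sposet.
      right_sposet S A \<longrightarrow> carrier A \<noteq> {} \<longrightarrow> weakly_regularly_d_injective S A"
proof (intro allI impI)
  fix A :: "('u, 'u) sposet"
  assume A: "right_sposet S A" and "carrier A \<noteq> {}"
  interpret pomonoid S by fact
  obtain a where a: "a \<in> carrier A" using \<open>carrier A \<noteq> {}\<close> by blast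
  obtain e :: "'u \<times> 'u \<Rightarrow> 'u" where e: "inj e"
    using infinite_inj_prod assms(1) by blast
  define P where "P = prod_sposet A (regular_sposet S)"
  \<comment> \<open>The assumption on generators ranges over carriers in \<open>'u\<close>, whereas
    \<open>P\<close> lives in \<open>'u \<times> 'u\<close>.\<close>
  define G where "G = image_sposet e P"
  have G: "right_sposet S G"
    unfolding G_def P_def by (intro right_sposet_image right_sposet_prod e A right_sposet_regular)
  have to_P: "inv_into UNIV e \<in> sposet_hom S G P"
    unfolding G_def by (rule inv_image_sposet_hom[OF e])
  have "snd \<circ> inv_into UNIV e \<in> sposet_hom S G (regular_sposet S)"
    using to_P snd_sposet_hom unfolding P_def by (rule sposet_hom_comp)
  moreover have "\<one>\<^bsub>S\<^esub> \<in> (snd \<circ> inv_into UNIV e) ` carrier G"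
  proof (rule image_eqI)
    \<comment> \<open>Nonemptiness of \<open>A\<close> enters here: the point \<open>a\<close>
      yields an element of the product lying over the identity.\<close>
    show "e (a, \<one>\<^bsub>S\<^esub>) \<in> carrier G"
      using a by (simp add: G_def P_def image_sposet_def prod_sposet_def regular_sposet_def)
  qed (simp add: e)
  ultimately have "generator S G" by (rule generatorI)
  with G have "weakly_regularly_d_injective S G" using assms(3) by blast
  moreover have "fst \<circ> inv_into UNIV e \<in> sposet_hom S G A"
    using to_P fst_sposet_hom unfolding P_def by (rule sposet_hom_comp)
  ultimately show "weakly_regularly_d_injective S A"
  proof (rule weakly_regularly_d_injective_retract)
    fix I u
    assume I: "right_poideal S I" and u: "u \<in> sposet_hom S (poideal_sposet S I) A"
    have "(\<lambda>x. (u x, x)) \<in> sposet_hom S (poideal_sposet S I) P"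
      unfolding P_def by (intro pair_sposet_hom u poideal_inclusion_sposet_hom I)
    \<comment> \<open>The lift of \<open>u\<close> to \<open>G\<close> is the pairing with the
      inclusion of \<open>I\<close>, moved along \<open>e\<close>; the projection undoes
      \<open>e\<close> and keeps the component \<open>u\<close>.\<close>
    then have "e \<circ> (\<lambda>x. (u x, x)) \<in> sposet_hom S (poideal_sposet S I) G"
      unfolding G_def using image_sposet_hom[OF e] by (rule sposet_hom_comp)
    then show "\<exists>w \<in> sposet_hom S (poideal_sposet S I) G. \<forall>x \<in> I. (fst \<circ> inv_into UNIV e) (w x) = u x"
      using e by (intro bexI) auto
  qed
qed

end
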